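(* Let $1\leq k\leq n$ be integers. Let $\hat{A}_{k,n}$ be the set of total cyclic orders $\pi$ on $[n]=\{0,1,\ldots,n\}$ such that for every $0\leq i\leq n-k$, the $(k+1)$-tuple $(i,i+1,\ldots,i+k)$ forms a $\pi$-chain. Let $\hat{B}_{k,n}$ be the set of all $(x_1,\ldots,x_n)\in[0,1]^n$ such that $x_{i+1}+\cdots+x_{i+k}\leq 1$ for all $0\leq i\leq n-k$. Then $\hat{B}_{k,n}$ is a lattice polytope (all its vertices lie in $\mathbb{Z}^n$) and \[ n!\,\mathrm{vol}(\hat{B}_{k,n}) = \#\hat{A}_{k,n}. \]
   Context: A cyclic order on a set $X$ is a set $\pi\subset X^3$ of triples such that: (i) $(x,y,z)\in\pi\Rightarrow(y,z,x)\in\pi$; (ii) $(x,y,z)\in\pi\Rightarrow(z,y,x)\notin\pi$; (iii) $(x,y,z)\in\pi$ and $(x,z,u)\in\pi$ imply $(x,y,u)\in\pi$. It is total if for every triple of distinct elements $x,y,z$, either $(x,y,z)\in\pi$ or $(z,y,x)\in\pi$. For a total cyclic order $\pi$ on $[n]$ and $m\geq3$, an $m$-tuple $(x_1,\ldots,x_m)$ of distinct elements of $[n]$ is a $\pi$-chain if $(x_1,x_i,x_{i+1})\in\pi$ for all $2\leq i\leq m-1$; every pair $(x_1,x_2)$ of distinct elements is by convention a $\pi$-chain. $\mathrm{vol}$ denotes Lebesgue measure. *)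

theory Defs
  imports "HOL-Analysis.Analysis"
begin

definition cyclic_order_on :: "'a set \<Rightarrow> ('a \<times> 'a \<times> 'a) set \<Rightarrow> bool" where
  "cyclic_order_on X \<pi> \<longleftrightarrow>
     \<pi> \<subseteq> X \<times> X \<times> X \<and>
     (\<forall>x y z. (x, y, z) \<in> \<pi> \<longrightarrow> (y, z, x) \<in> \<pi>) \<and>
     (\<forall>x y z. (x, y, z) \<in> \<pi> \<longrightarrow> (z, y, x) \<notin> \<pi>) \<and>
     (\<forall>x y z u. (x, y, z) \<in> \<pi> \<and> (x, z, u) \<in> \<pi> \<longrightarrow> (x, y, u) \<in> \<pi>)"

definition total_cyclic_order_on :: "'a set \<Rightarrow> ('a \<times> 'a \<times> 'a) set \<Rightarrow> bool" where
  "total_cyclic_order_on X \<pi> \<longleftrightarrow>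
     cyclic_order_on X \<pi> \<and>
     (\<forall>x\<in>X. \<forall>y\<in>X. \<forall>z\<in>X. x \<noteq> y \<and> y \<noteq> z \<and> x \<noteq> z \<longrightarrow> (x, y, z) \<in> \<pi> \<or> (z, y, x) \<in> \<pi>)"

text \<open>Tuples are lists, indexed from 0. For lists of length 2 the last conjunct is vacuous, so every
  pair of distinct elements is a chain.\<close>

definition cyclic_chain :: "'a set \<Rightarrow> ('a \<times> 'a \<times> 'a) set \<Rightarrow> 'a list \<Rightarrow> bool" where
  "cyclic_chain X \<pi> xs \<longleftrightarrow>
     2 \<le> length xs \<and> distinct xs \<and> set xs \<subseteq> X \<and>
     (\<forall>i. 1 \<le> i \<and> i + 1 < length xs \<longrightarrow> (xs ! 0, xs ! i, xs ! (i + 1)) \<in> \<pi>)"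

definition A_hat :: "nat \<Rightarrow> nat \<Rightarrow> (nat \<times> nat \<times> nat) set set" where
  "A_hat k n = {\<pi>. total_cyclic_order_on {0..n} \<pi> \<and>
     (\<forall>i. i + k \<le> n \<longrightarrow> cyclic_chain {0..n} \<pi> [i..<i + k + 1])}"

text \<open>Euclidean \<open>n\<close>-space is \<open>real ^ 'n\<close> for a finite type \<open>'n\<close>; a bijection \<open>e\<close> from \<open>{1..n}\<close> onto
  \<open>'n\<close> names the coordinates, the \<open>j\<close>-th coordinate of \<open>x\<close> being \<open>x $ e j\<close>.\<close>

definition B_hat :: "(nat \<Rightarrow> 'n) \<Rightarrow> nat \<Rightarrow> nat \<Rightarrow> (real ^ 'n::finite) set" where
  "B_hat e k n = {x. (\<forall>j\<in>{1..n}. x $ e j \<in> {0..1}) \<and>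
     (\<forall>i. i + k \<le> n \<longrightarrow> (\<Sum>j = i + 1..i + k. x $ e j) \<le> 1)}"

definition lattice_polytope :: "(real ^ 'n::finite) set \<Rightarrow> bool" where
  "lattice_polytope P \<longleftrightarrow> polytope P \<and> (\<forall>v. v extreme_point_of P \<longrightarrow> (\<forall>a. v $ a \<in> \<int>))"

end

theory Submission
  imports Defs "HOL-Combinatorics.Permutations"
begin

text \<open>Reading \<open>x\<close> as the successive clockwise steps of a walk on the circle \<open>\<real>/\<int>\<close> that starts at \<open>0\<close>
  gives positions \<open>y\<^sub>j = x\<^sub>1 + \<dots> + x\<^sub>j\<close> modulo 1. For generic \<open>x\<close> these are distinct and induce a
  total cyclic order on \<open>{0..n}\<close>; the inequality \<open>x\<^sub>i\<^sub>+\<^sub>1 + \<dots> + x\<^sub>i\<^sub>+\<^sub>k \<le> 1\<close> says that the walk makes less than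
  one turn between times \<open>i\<close> and \<open>i + k\<close>, that is, that \<open>(i, \<dots>, i + k)\<close> is a chain. The positions
  realising a given cyclic order form a simplex; these simplices are permuted by permutations of
  the coordinates, and the passage from \<open>y\<close> to \<open>x\<close> is affine on each of them with one common linear
  part. Hence all cyclic orders contribute the same volume, and the case \<open>k = 1\<close>, where the polytope
  is the unit cube and all \<open>n!\<close> orders occur, shows that this volume is \<open>1/n!\<close>. The vertices are
  integral because in terms of the partial sums the polytope is cut out by bounds on differences with
  integral right-hand sides.\<close>

section \<open>Cyclic orders as circular arrangements of ranks\<close>

text \<open>Some rotation of \<open>(a, b, c)\<close> is increasing: the three values are met
  clockwise once the line is closed up to a circle. The type is left open because both ranks in
  \<open>nat\<close> and positions in \<open>real\<close> are compared this way.\<close>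

definition cw :: "'a::linorder \<Rightarrow> 'a \<Rightarrow> 'a \<Rightarrow> bool" where
  "cw a b c \<longleftrightarrow> a < b \<and> b < c \<or> b < c \<and> c < a \<or> c < a \<and> a < b"

text \<open>\<open>p j\<close> is the place of the point \<open>j\<close> on the circle. The
  intended \<open>p\<close> permute \<open>{1..n}\<close>, so the point 0 keeps place 0, which
  removes the freedom of rotation.\<close>

definition cyclic_of :: "nat \<Rightarrow> (nat \<Rightarrow> nat) \<Rightarrow> (nat \<times> nat \<times> nat) set" where
  "cyclic_of n p = {(a, b, c). a \<le> n \<and> b \<le> n \<and> c \<le> n \<and> cw (p a) (p b) (p c)}"

lemma permutes_fixes_0: "p permutes {1..n} \<Longrightarrow> p 0 = (0::nat)"
  by (rule permutes_not_in) auto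

lemma total_cyclic_order_cyclic_of:
  assumes "p permutes {1..n}"
  shows "total_cyclic_order_on {0..n} (cyclic_of n p)"
proof -
  have "inj p"
    using assms permutes_inj by blast
  then have "p x = p y \<longleftrightarrow> x = y" for x y
    by (simp add: inj_eq)
  then have tot: "cw (p x) (p y) (p z) \<or> cw (p z) (p y) (p x)"
    if "x \<noteq> y" "y \<noteq> z" "x \<noteq> z" for x y z
    using that unfolding cw_def by (meson linorder_neqE_nat)
  show ?thesis
    unfolding total_cyclic_order_on_def cyclic_order_on_def
  proof (intro conjI)
    show "cyclic_of n p \<subseteq> {0..n} \<times> {0..n} \<times> {0..n}"
      by (auto simp: cyclic_of_def)
    show "\<forall>x\<in>{0..n}. \<forall>y\<in>{0..n}. \<forall>z\<in>{0..n}. x \<noteq> y \<and> y \<noteq> z \<and> x \<noteq> z \<longrightarrow>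
        (x, y, z) \<in> cyclic_of n p \<or> (z, y, x) \<in> cyclic_of n p"
      using tot by (auto simp: cyclic_of_def)
  qed (auto simp: cyclic_of_def cw_def)
qed

lemma permutes_rank:
  assumes p: "p permutes {1..n}" and i: "i \<in> {1..n}"
  shows "card {j \<in> {1..n}. p j \<le> p i} = p i"
proof -
  have "p ` {j \<in> {1..n}. p j \<le> p i} = {1..p i}"
  proof (intro equalityI subsetI)
    fix x assume "x \<in> p ` {j \<in> {1..n}. p j \<le> p i}"
    then show "x \<in> {1..p i}"
      using permutes_in_image[OF p] by fastforce
  next
    fix x assume x: "x \<in> {1..p i}"
    have "p i \<in> {1..n}"
      using permutes_in_image[OF p] i by blast
    then have "x \<in> p ` {1..n}"
      using x permutes_image[OF p] by auto
    then show "x \<in> p ` {j \<in> {1..n}. p j \<le> p i}"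
      using x by auto
  qed
  moreover have "card (p ` {j \<in> {1..n}. p j \<le> p i}) = card {j \<in> {1..n}. p j \<le> p i}"
    using permutes_inj[OF p] by (intro card_image) (auto intro: inj_on_subset)
  ultimately show ?thesis by simp
qed

text \<open>On \<open>{1..n}\<close> each value can be recovered from the order alone, by the
  counting in \<open>permutes_rank\<close>.\<close>

lemma permutes_eqI:
  assumes p: "p permutes {1..n}" and q: "q permutes {1..n}"
    and less: "\<And>i j. i \<in> {1..n} \<Longrightarrow> j \<in> {1..n} \<Longrightarrow> p i < p j \<longleftrightarrow> q i < q j"
  shows "p = (q :: nat \<Rightarrow> nat)"
proof
  fix i
  show "p i = q i"
  proof (cases "i \<in> {1..n}")
    case i: True
    then have "{j \<in> {1..n}. p j \<le> p i} = {j \<in> {1..n}. q j \<le> q i}"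
      using less by (auto simp flip: not_less)
    then show ?thesis
      using permutes_rank[OF p i] permutes_rank[OF q i] by simp
  next
    case False
    then show ?thesis
      using permutes_not_in[OF p] permutes_not_in[OF q] by simp
  qed
qed

text \<open>The rank of \<open>i\<close> counts \<open>i\<close> and its predecessors, collected in
  \<open>D i\<close>. This serves twice: for a cyclic order cut open at 0, and for the fractional
  parts of partial sums.\<close>

lemma strict_total_order_rank:
  fixes R :: "nat \<Rightarrow> nat \<Rightarrow> bool"
  assumes trans: "\<And>i j l. R i j \<Longrightarrow> R j l \<Longrightarrow> R i l" and irrefl: "\<And>i. \<not> R i i"
    and total: "\<And>i j. i \<in> {1..n} \<Longrightarrow> j \<in> {1..n} \<Longrightarrow> i \<noteq> j \<Longrightarrow> R i j \<or> R j i"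
  obtains r where "r permutes {1..n}"
    "\<And>i j. i \<in> {1..n} \<Longrightarrow> j \<in> {1..n} \<Longrightarrow> r i < r j \<longleftrightarrow> R i j"
proof -
  define D where "D i = {j \<in> {1..n}. j = i \<or> R j i}" for i
  define r where "r i = (if i \<in> {1..n} then card (D i) else i)" for i
  have fin: "finite (D i)" for i by (simp add: D_def)
  have mono: "r i < r j" if "R i j" "i \<in> {1..n}" "j \<in> {1..n}" for i j
  proof -
    have "D i \<subseteq> D j"
      using that trans unfolding D_def by blast
    moreover have "j \<in> D j" "j \<notin> D i"
      using that irrefl trans unfolding D_def by blast+
    ultimately have "D i \<subset> D j" by blast
    then show ?thesis
      using that fin by (simp add: r_def psubset_card_mono)
  qed
  have less_iff: "r i < r j \<longleftrightarrow> R i j" if "i \<in> {1..n}" "j \<in> {1..n}" for i j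
    using that total mono by (metis less_asym less_irrefl)
  have range: "r i \<in> {1..n}" if "i \<in> {1..n}" for i
  proof -
    have "card {i} \<le> card (D i)"
      using fin that by (intro card_mono) (auto simp: D_def)
    moreover have "card (D i) \<le> card {1..n}"
      by (intro card_mono) (auto simp: D_def)
    ultimately show ?thesis using that by (simp add: r_def)
  qed
  have inj: "inj_on r {1..n}"
    using total mono by (intro inj_onI) (metis less_irrefl)
  then have "r ` {1..n} = {1..n}"
    using range by (intro endo_inj_surj) auto
  then have "r permutes {1..n}"
    using inj by (intro bij_imp_permutes) (auto simp: bij_betw_def r_def)
  with less_iff show ?thesis using that by blast
qed

text \<open>Since 0 has place 0, the triples \<open>(0, i, j)\<close> reveal every comparison
  \<open>p i < p j\<close>.\<close>

lemma inj_on_cyclic_of: "inj_on (cyclic_of n) {p. p permutes {1..n}}"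
proof (rule inj_onI, clarify)
  fix p q assume p: "p permutes {1..n}" and q: "q permutes {1..n}" and eq: "cyclic_of n p = cyclic_of n q"
  have pos: "r i > 0" if "r permutes {1..n}" "i \<in> {1..n}" for r i
    using that permutes_in_image[of r "{1..n}" i] by auto
  have less_iff: "r i < r j \<longleftrightarrow> (0, i, j) \<in> cyclic_of n r"
    if r: "r permutes {1..n}" and "i \<in> {1..n}" "j \<in> {1..n}" for r i j
    using pos[of r i] pos[of r j] permutes_fixes_0[OF r] that by (auto simp: cyclic_of_def cw_def)
  show "p = q"
    using permutes_eqI[OF p q] less_iff[OF p] less_iff[OF q] eq by simp
qed

text \<open>Cutting \<open>\<pi>\<close> open at 0 leaves the linear order
  \<open>(0, i, j) \<in> \<pi>\<close> on \<open>{1..n}\<close>, with rank function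
  \<open>r\<close>. Transitivity and rotation put every clockwise triple of ranks into
  \<open>\<pi>\<close>; asymmetry then excludes all other triples.\<close>

lemma total_cyclic_order_rank:
  assumes "total_cyclic_order_on {0..n} \<pi>"
  obtains r where "r permutes {1..n}" "cyclic_of n r = \<pi>"
proof -
  note ax = assms[unfolded total_cyclic_order_on_def cyclic_order_on_def]
  have sub: "\<pi> \<subseteq> {0..n} \<times> {0..n} \<times> {0..n}"
    using ax by (elim conjE)
  have "\<forall>x y z. (x, y, z) \<in> \<pi> \<longrightarrow> (y, z, x) \<in> \<pi>"
    using ax by (elim conjE)
  then have rot: "(y, z, x) \<in> \<pi>" if "(x, y, z) \<in> \<pi>" for x y z
    using that by iprover
  have "\<forall>x y z. (x, y, z) \<in> \<pi> \<longrightarrow> (z, y, x) \<notin> \<pi>"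
    using ax by (elim conjE)
  then have asym: "(z, y, x) \<notin> \<pi>" if "(x, y, z) \<in> \<pi>" for x y z
    using that by iprover
  have "\<forall>x y z u. (x, y, z) \<in> \<pi> \<and> (x, z, u) \<in> \<pi> \<longrightarrow> (x, y, u) \<in> \<pi>"
    using ax by (elim conjE)
  then have trans: "(x, y, u) \<in> \<pi>" if "(x, y, z) \<in> \<pi>" "(x, z, u) \<in> \<pi>" for x y z u
    using that by iprover
  have "\<forall>x\<in>{0..n}. \<forall>y\<in>{0..n}. \<forall>z\<in>{0..n}. x \<noteq> y \<and> y \<noteq> z \<and> x \<noteq> z \<longrightarrow>
      (x, y, z) \<in> \<pi> \<or> (z, y, x) \<in> \<pi>"
    using ax by (elim conjE)
  then have total: "(x, y, z) \<in> \<pi> \<or> (z, y, x) \<in> \<pi>"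
    if "x \<le> n" "y \<le> n" "z \<le> n" "x \<noteq> y" "y \<noteq> z" "x \<noteq> z" for x y z
    using that by (meson atLeastAtMost_iff zero_le)
  have irrefl: "(x, x, z) \<notin> \<pi>" for x z
  proof
    assume "(x, x, z) \<in> \<pi>"
    from rot[OF rot[OF this]] asym[OF this] show False by contradiction
  qed
  have dist: "x \<noteq> y" "y \<noteq> z" "x \<noteq> z" if "(x, y, z) \<in> \<pi>" for x y z
    using that irrefl rot[OF that] asym[OF that] by auto
  have comparable: "(0, i, j) \<in> \<pi> \<or> (0, j, i) \<in> \<pi>" if "i \<in> {1..n}" "j \<in> {1..n}" "i \<noteq> j" for i j
    using total[of 0 i j] that rot[OF rot[of j i 0]] rot[of i j 0] rot[of j 0 i] by auto
  have "\<not> (0, i, i) \<in> \<pi>" for i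
    using dist(2)[of 0 i i] by auto
  then obtain r where perm: "r permutes {1..n}"
    and r: "\<And>i j. i \<in> {1..n} \<Longrightarrow> j \<in> {1..n} \<Longrightarrow> r i < r j \<longleftrightarrow> (0, i, j) \<in> \<pi>"
    using strict_total_order_rank[of "\<lambda>i j. (0, i, j) \<in> \<pi>" n] trans comparable by blast
  have r0: "r 0 = 0" using perm by (rule permutes_fixes_0)
  have less: "(0, i, j) \<in> \<pi>" if "r i < r j" "i \<in> {1..n}" "j \<in> {1..n}" for i j
    using that r by blast
  have incr: "(a, b, c) \<in> \<pi>" if "r a < r b" "r b < r c" "a \<le> n" "b \<le> n" "c \<le> n" for a b c
  proof -
    have bc: "b \<in> {1..n}" "c \<in> {1..n}"
      using that r0 by (metis atLeastAtMost_iff less_one not_less not_less_zero)+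
    then have 1: "(0, b, c) \<in> \<pi>" using less that by blast
    show ?thesis
    proof (cases "a = 0")
      case True
      then show ?thesis using 1 by simp
    next
      case False
      then have "(0, a, b) \<in> \<pi>" using less that bc by simp
      \<comment> \<open>The base point moves from 0 to \<open>b\<close>: there transitivity joins
        \<open>(b, c, 0)\<close> and \<open>(b, 0, a)\<close> to \<open>(b, c, a)\<close>, a
        rotation of the goal.\<close>
      then have "(b, 0, a) \<in> \<pi>" and "(b, c, 0) \<in> \<pi>" using rot[OF rot] rot[OF 1] by iprover+
      from rot[OF rot[OF trans[OF this(2,1)]]] show ?thesis .
    qed
  qed
  have cw_in: "(a, b, c) \<in> \<pi>" if "cw (r a) (r b) (r c)" "a \<le> n" "b \<le> n" "c \<le> n" for a b c
    using that(1) incr[of a b c] rot[OF rot[OF incr[of b c a]]] rot[OF incr[of c a b]] that(2-)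
    unfolding cw_def by iprover
  have "cw (r a) (r b) (r c)" if "(a, b, c) \<in> \<pi>" for a b c
  proof (rule ccontr)
    assume not: "\<not> cw (r a) (r b) (r c)"
    have le: "a \<le> n" "b \<le> n" "c \<le> n" using that sub by auto
    have "inj r" using perm permutes_inj by blast
    then have "r a \<noteq> r b" "r b \<noteq> r c" "r a \<noteq> r c"
      using dist[OF that] by (auto simp: inj_eq)
    then have "cw (r c) (r b) (r a)"
      using not unfolding cw_def by linarith
    then show False
      using cw_in le asym that by blast
  qed
  then have "cyclic_of n r = \<pi>"
    using cw_in sub unfolding cyclic_of_def by fastforce
  with perm show ?thesis using that by blast
qed

lemma bij_betw_cyclic_of:
  "bij_betw (cyclic_of n) {p. p permutes {1..n}} {\<pi>. total_cyclic_order_on {0..n} \<pi>}"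
  unfolding bij_betw_def
  using inj_on_cyclic_of total_cyclic_order_cyclic_of by (auto elim: total_cyclic_order_rank)

lemma cyclic_chain_cyclic_of:
  assumes "1 \<le> k" "i + k \<le> n"
  shows "cyclic_chain {0..n} (cyclic_of n p) [i..<i + k + 1] \<longleftrightarrow>
    (\<forall>a. 1 \<le> a \<and> a < k \<longrightarrow> cw (p i) (p (i + a)) (p (i + a + 1)))"
proof -
  have "(\<forall>a. 1 \<le> a \<and> a + 1 < length [i..<i + k + 1] \<longrightarrow>
       ([i..<i + k + 1] ! 0, [i..<i + k + 1] ! a, [i..<i + k + 1] ! (a + 1)) \<in> cyclic_of n p) \<longleftrightarrow>
    (\<forall>a. 1 \<le> a \<and> a < k \<longrightarrow> cw (p i) (p (i + a)) (p (i + a + 1)))"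
  proof (intro all_cong1 imp_cong)
    fix a
    show "1 \<le> a \<and> a + 1 < length [i..<i + k + 1] \<longleftrightarrow> 1 \<le> a \<and> a < k" by auto
    assume a: "1 \<le> a \<and> a < k"
    then have "[i..<i + k + 1] ! 0 = i" "[i..<i + k + 1] ! a = i + a" "[i..<i + k + 1] ! (a + 1) = i + a + 1"
      using assms by (simp_all del: upt_Suc add: nth_upt)
    then show "([i..<i + k + 1] ! 0, [i..<i + k + 1] ! a, [i..<i + k + 1] ! (a + 1)) \<in> cyclic_of n p \<longleftrightarrow>
      cw (p i) (p (i + a)) (p (i + a + 1))"
      using a assms by (simp add: cyclic_of_def del: upt_Suc)
  qed
  moreover have "set [i..<i + k + 1] \<subseteq> {0..n}"
    using assms by auto
  ultimately show ?thesis
    using assms unfolding cyclic_chain_def by (simp del: upt_Suc)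
qed

section \<open>Walks on the circle\<close>

text \<open>The length of the clockwise arc from \<open>u\<close> to \<open>v\<close> on the circle
  of circumference 1, for representatives in \<open>[0, 1)\<close>. Equal points have distance 0,
  not 1.\<close>

definition cw_dist :: "real \<Rightarrow> real \<Rightarrow> real" where
  "cw_dist u v = (if u \<le> v then v - u else v - u + 1)"

text \<open>The sum is the length of the walk through \<open>Y i, ..., Y (i + k)\<close>. While the
  points come in clockwise order from \<open>Y i\<close>, the length walked so far,
  \<open>S m\<close>, is the direct arc from \<open>Y i\<close> to \<open>Y (i + m)\<close>, hence
  at most 1. The first step that passes \<open>Y i\<close> again adds a full turn to a positive arc
  and so exceeds 1.\<close>

lemma sum_cw_dist_le_1_iff_cw:
  fixes Y :: "nat \<Rightarrow> real"
  assumes Y: "\<And>j. j \<in> {i..i + k} \<Longrightarrow> 0 \<le> Y j \<and> Y j < 1" and inj: "inj_on Y {i..i + k}"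
  shows "(\<Sum>j = i + 1..i + k. cw_dist (Y (j - 1)) (Y j)) \<le> 1 \<longleftrightarrow>
    (\<forall>a. 1 \<le> a \<and> a < k \<longrightarrow> cw (Y i) (Y (i + a)) (Y (i + a + 1)))"
proof -
  define S where "S m = (\<Sum>j = i + 1..i + m. cw_dist (Y (j - 1)) (Y j))" for m
  have S0: "S 0 = 0" by (simp add: S_def)
  have S_Suc: "S (Suc m) = S m + cw_dist (Y (i + m)) (Y (i + m + 1))" for m
    by (simp add: S_def)
  have neq: "Y (i + a) \<noteq> Y (i + b)" if "a \<noteq> b" "a \<le> k" "b \<le> k" for a b
    using inj_onD[OF inj, of "i + a" "i + b"] that by auto
  have bd: "0 \<le> Y (i + a) \<and> Y (i + a) < 1" if "a \<le> k" for a
    using Y that by simp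
  show ?thesis
  proof
    assume cw: "\<forall>a. 1 \<le> a \<and> a < k \<longrightarrow> cw (Y i) (Y (i + a)) (Y (i + a + 1))"
    have "m \<le> k \<Longrightarrow> S m = cw_dist (Y i) (Y (i + m))" for m
    proof (induction m)
      case 0
      then show ?case by (simp add: S0 cw_dist_def)
    next
      case (Suc m)
      show ?case
      proof (cases "m = 0")
        case True
        then show ?thesis using S_Suc[of 0] S0 by simp
      next
        case False
        then have "cw (Y i) (Y (i + m)) (Y (i + m + 1))" using cw Suc.prems by simp
        then have "cw_dist (Y i) (Y (i + m)) + cw_dist (Y (i + m)) (Y (i + m + 1)) = cw_dist (Y i) (Y (i + m + 1))"
          unfolding cw_def cw_dist_def by auto
        then show ?thesis using Suc S_Suc by simp
      qed
    qed
    then have "S k = cw_dist (Y i) (Y (i + k))" by simp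
    also have "\<dots> \<le> 1" using bd[of 0] bd[of k] by (simp add: cw_dist_def)
    finally show "(\<Sum>j = i + 1..i + k. cw_dist (Y (j - 1)) (Y j)) \<le> 1" by (simp add: S_def)
  next
    assume "(\<Sum>j = i + 1..i + k. cw_dist (Y (j - 1)) (Y j)) \<le> 1"
    then have Sk: "S k \<le> 1" by (simp add: S_def)
    have S_le: "S m \<le> 1" if "m \<le> k" for m
    proof -
      have "S m \<le> S k"
        unfolding S_def
      proof (rule sum_mono2)
        fix j assume "j \<in> {i + 1..i + k} - {i + 1..i + m}"
        then have "j - 1 \<in> {i..i + k}" "j \<in> {i..i + k}" by auto
        then show "0 \<le> cw_dist (Y (j - 1)) (Y j)"
          using Y[of j] Y[of "j - 1"] unfolding cw_dist_def by auto
      qed (use that in auto)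
      then show ?thesis using Sk by simp
    qed
    \<comment> \<open>Two consecutive arcs add up to the direct arc or to that arc plus 1. Distinct
      points make the direct arc positive, so the bound 1 excludes the second case.\<close>
    have step: "cw_dist (Y i) (Y (i + m)) + cw_dist (Y (i + m)) (Y (i + m + 1)) = cw_dist (Y i) (Y (i + m + 1)) \<and>
        cw (Y i) (Y (i + m)) (Y (i + m + 1))"
      if "S m = cw_dist (Y i) (Y (i + m))" "1 \<le> m" "m < k" for m
    proof -
      have "cw_dist (Y i) (Y (i + m)) + cw_dist (Y (i + m)) (Y (i + m + 1)) \<le> 1"
        using S_le[of "Suc m"] S_Suc[of m] that by simp
      moreover have "Y i \<noteq> Y (i + m)" "Y (i + m) \<noteq> Y (i + m + 1)" "Y i \<noteq> Y (i + m + 1)"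
        using neq[of 0 m] neq[of m "m + 1"] neq[of 0 "m + 1"] that by auto
      ultimately show ?thesis
        using bd[of 0] bd[of m] bd[of "m + 1"] that unfolding cw_dist_def cw_def
        by (simp split: if_splits)
    qed
    have S_eq: "m \<le> k \<Longrightarrow> S m = cw_dist (Y i) (Y (i + m))" for m
    proof (induction m)
      case 0
      then show ?case by (simp add: S0 cw_dist_def)
    next
      case (Suc m)
      then show ?case
        using step[of m] S_Suc[of m] S0 by (cases "m = 0") auto
    qed
    show "\<forall>a. 1 \<le> a \<and> a < k \<longrightarrow> cw (Y i) (Y (i + a)) (Y (i + a + 1))"
      using step S_eq by simp
  qed
qed

section \<open>Lebesgue measure under linear maps\<close>

text \<open>The library computes the factor as a determinant, but only for well-ordered index types.\<close>

lemma linear_image_scales_lebesgue: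
  fixes f :: "real ^ 'n \<Rightarrow> real ^ 'n"
  assumes "linear f"
  shows "\<exists>c. \<forall>S\<in>lmeasurable. f ` S \<in> lmeasurable \<and> measure lebesgue (f ` S) = c * measure lebesgue S"
    (is "?P f")
proof (rule induct_linear_elementary[of f ?P, OF assms])
  fix f g :: "real ^ 'n \<Rightarrow> real ^ 'n"
  assume "?P f" "?P g"
  then obtain c d where
    c: "\<And>S. S \<in> lmeasurable \<Longrightarrow> f ` S \<in> lmeasurable \<and> measure lebesgue (f ` S) = c * measure lebesgue S" and
    d: "\<And>S. S \<in> lmeasurable \<Longrightarrow> g ` S \<in> lmeasurable \<and> measure lebesgue (g ` S) = d * measure lebesgue S"
    by auto
  show "?P (f \<circ> g)"
    using c d by (intro exI[of _ "c * d"]) (simp flip: image_image add: comp_def)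
next
  fix f :: "real ^ 'n \<Rightarrow> real ^ 'n" and i
  assume f: "linear f" "\<And>x. f x $ i = 0"
  \<comment> \<open>The all-ones vector is missed because coordinate \<open>i\<close> of every image
    is 0, so \<open>f\<close> is singular.\<close>
  have "f x \<noteq> 1" for x
    using f(2)[of x] by (metis one_index zero_neq_one)
  then have "\<not> surj f"
    by (metis surjD)
  then have "\<not> inj f"
    using linear_injective_imp_surjective[OF f(1)] by blast
  then have "negligible (f ` S)" for S
    using negligible_linear_singular_image[OF f(1)] by blast
  then show "?P f"
    by (intro exI[of _ 0]) (simp add: negligible_imp_measurable negligible_imp_measure0)
next
  fix c :: "'n \<Rightarrow> real"
  show "?P (\<lambda>x. \<chi> i. c i * x $ i)"
    by (intro exI[of _ "\<bar>prod c UNIV\<bar>"]) (simp add: measurable_stretch measure_stretch)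
next
  fix m n :: 'n
  define h where "h = (\<lambda>x :: real ^ 'n. \<chi> i. x $ Transposition.transpose m n i)"
  have lin: "linear h"
    by (rule linearI) (auto simp: h_def vec_eq_iff)
  have h_h: "h (h x) = x" for x
    by (simp add: h_def vec_eq_iff)
  \<comment> \<open>It suffices to compare measures on boxes, and the involution \<open>h\<close>
    turns boxes into boxes.\<close>
  have "h ` cbox a b = cbox (h a) (h b)" for a b
  proof -
    have *: "h x \<in> cbox (h a) (h b)" if "x \<in> cbox a b" for x a b
      using that by (simp add: h_def mem_box_cart)
    show ?thesis
      using *[of _ a b] *[of _ "h a" "h b"] h_h by (auto simp: image_iff) metis
  qed
  moreover have "measure lebesgue (cbox (h a) (h b)) = measure lebesgue (cbox a b)" for a b
  proof -
    have "(\<Prod>i\<in>UNIV. h b $ i - h a $ i) = (\<Prod>i\<in>UNIV. b $ i - a $ i)"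
      using prod.permute[OF permutes_swap_id[of m UNIV n], of "\<lambda>i. b $ i - a $ i"]
      by (simp add: h_def comp_def)
    moreover have "(\<forall>i. h a $ i \<le> h b $ i) \<longleftrightarrow> (\<forall>i. a $ i \<le> b $ i)"
      unfolding h_def by (metis transpose_involutory vec_lambda_beta)
    ultimately show ?thesis
      by (auto simp: content_cbox_if_cart interval_eq_empty_cart simp flip: not_le)
  qed
  ultimately have "h ` S \<in> lmeasurable \<and> measure lebesgue (h ` S) = 1 * measure lebesgue S"
    if "S \<in> lmeasurable" for S
    using measure_linear_sufficient[OF lin that, of 1] by simp
  then show "?P (\<lambda>x. \<chi> i. x $ Transposition.transpose m n i)"
    unfolding h_def by blast
next
  fix m n :: 'n assume "m \<noteq> n"
  define h where "h = (\<lambda>x :: real ^ 'n. \<chi> i. if i = m then x $ m + x $ n else x $ i)"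
  have lin: "linear h"
    by (rule linearI) (auto simp: h_def vec_eq_iff algebra_simps)
  have "measure lebesgue (h ` cbox a b) = measure lebesgue (cbox a b)" for a b
  proof (cases "cbox a b = {}")
    case False
    \<comment> \<open>\<open>measure_shear_interval\<close> asks for a nonnegative lower bound in
      coordinate \<open>n\<close>. Translating by \<open>v\<close> makes this bound 0 and preserves
      both measures.\<close>
    define v where "v = axis n (a $ n)"
    have tr: "cbox a b = (+) v ` cbox (a - v) (b - v)"
      using cbox_translation[of v "a - v" "b - v"] by simp
    then have ne: "cbox (a - v) (b - v) \<noteq> {}"
      using False by auto
    have "h ` cbox a b = (+) (h v) ` h ` cbox (a - v) (b - v)"
      unfolding tr image_image using linear_add[OF lin] by simp
    then have "measure lebesgue (h ` cbox a b) = measure lebesgue (h ` cbox (a - v) (b - v))"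
      by (simp only: measure_translation)
    also have "\<dots> = measure lebesgue (cbox (a - v) (b - v))"
      unfolding h_def using ne \<open>m \<noteq> n\<close> by (intro measure_shear_interval) (auto simp: v_def)
    also have "\<dots> = measure lebesgue (cbox a b)"
      unfolding tr by (simp only: measure_translation)
    finally show ?thesis .
  qed simp
  then have "h ` S \<in> lmeasurable \<and> measure lebesgue (h ` S) = 1 * measure lebesgue S"
    if "S \<in> lmeasurable" for S
    using measure_linear_sufficient[OF lin that, of 1] by simp
  then show "?P (\<lambda>x. \<chi> i. if i = m then x $ m + x $ n else x $ i)"
    unfolding h_def by blast
qed

text \<open>The scaling factor does not depend on the set, and the unit cube is mapped onto itself,
  so the factor is 1.\<close>

lemma permute_coordinates_preserves_lebesgue:
  fixes \<sigma> :: "'n::finite \<Rightarrow> 'n" and S :: "(real ^ 'n) set"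
  assumes "bij \<sigma>" "S \<in> lmeasurable"
  shows "measure lebesgue ((\<lambda>x. \<chi> i. x $ \<sigma> i) ` S) = measure lebesgue S"
proof -
  let ?f = "\<lambda>x :: real ^ 'n. \<chi> i. x $ \<sigma> i"
  have "linear ?f"
    by (rule linearI) (auto simp: vec_eq_iff)
  then obtain c where c: "\<And>S. S \<in> lmeasurable \<Longrightarrow> measure lebesgue (?f ` S) = c * measure lebesgue S"
    using linear_image_scales_lebesgue by blast
  have "?f ` cbox 0 1 = cbox 0 1"
  proof (intro equalityI subsetI)
    fix x :: "real ^ 'n" assume "x \<in> cbox 0 1"
    then have "(\<chi> i. x $ inv \<sigma> i) \<in> cbox 0 1" "x = ?f (\<chi> i. x $ inv \<sigma> i)"
      using assms(1) by (auto simp: mem_box_cart vec_eq_iff bij_is_inj)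
    then show "x \<in> ?f ` cbox 0 1" by blast
  qed (auto simp: mem_box_cart)
  moreover have "measure lebesgue (cbox 0 1 :: (real ^ 'n) set) = 1"
    by (simp add: content_cbox_if_cart interval_eq_empty_cart)
  ultimately have "c = 1"
    using c[of "cbox 0 1"] by simp
  then show ?thesis
    using c[OF assms(2)] by simp
qed

section \<open>Extreme points of polyhedra\<close>

text \<open>A small move along \<open>d\<close>, forwards or backwards, keeps tight constraints
  tight and slack ones valid by continuity. A nonzero \<open>d\<close> would therefore place
  \<open>v\<close> inside a segment of the polyhedron.\<close>

lemma tight_direction_at_extreme_point:
  fixes a :: "'i \<Rightarrow> 'a::real_inner"
  assumes "finite I" and v: "v extreme_point_of {x. \<forall>i\<in>I. a i \<bullet> x \<le> b i}"
    and tight: "\<And>i. i \<in> I \<Longrightarrow> a i \<bullet> v = b i \<Longrightarrow> a i \<bullet> d = 0"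
  shows "d = 0"
proof (rule ccontr)
  assume "d \<noteq> 0"
  have vI: "a i \<bullet> v \<le> b i" if "i \<in> I" for i
    using v that by (auto simp: extreme_point_of_def)
  have "\<forall>\<^sub>F \<epsilon> in at_right 0. a i \<bullet> (v + \<epsilon> *\<^sub>R d) \<le> b i \<and> a i \<bullet> (v - \<epsilon> *\<^sub>R d) \<le> b i" if i: "i \<in> I" for i
  proof (cases "a i \<bullet> v = b i")
    case True
    then show ?thesis
      using tight[OF i] by (simp add: inner_simps)
  next
    case False
    then have less: "a i \<bullet> v < b i" using vI[OF i] by simp
    have "((\<lambda>\<epsilon>. a i \<bullet> (v + \<epsilon> *\<^sub>R d)) \<longlongrightarrow> a i \<bullet> (v + 0 *\<^sub>R d)) (at_right 0)"
      "((\<lambda>\<epsilon>. a i \<bullet> (v - \<epsilon> *\<^sub>R d)) \<longlongrightarrow> a i \<bullet> (v - 0 *\<^sub>R d)) (at_right 0)"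
      by (intro tendsto_intros)+
    from this[THEN order_tendstoD(2)] have
      "\<forall>\<^sub>F \<epsilon> in at_right 0. a i \<bullet> (v + \<epsilon> *\<^sub>R d) < b i" "\<forall>\<^sub>F \<epsilon> in at_right 0. a i \<bullet> (v - \<epsilon> *\<^sub>R d) < b i"
      using less by simp_all
    then show ?thesis
      by eventually_elim simp
  qed
  then have "\<forall>\<^sub>F \<epsilon> in at_right 0. \<forall>i\<in>I. a i \<bullet> (v + \<epsilon> *\<^sub>R d) \<le> b i \<and> a i \<bullet> (v - \<epsilon> *\<^sub>R d) \<le> b i"
    using assms(1) by (simp add: eventually_ball_finite)
  moreover have "\<forall>\<^sub>F \<epsilon> in at_right 0. (\<epsilon>::real) > 0"
    by (simp add: eventually_at_right_less)
  ultimately have "\<forall>\<^sub>F \<epsilon> in at_right 0. (\<forall>i\<in>I. a i \<bullet> (v + \<epsilon> *\<^sub>R d) \<le> b i \<and> a i \<bullet> (v - \<epsilon> *\<^sub>R d) \<le> b i) \<and> \<epsilon> > 0"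
    by eventually_elim simp
  then obtain \<epsilon> where "\<epsilon> > 0" "\<forall>i\<in>I. a i \<bullet> (v + \<epsilon> *\<^sub>R d) \<le> b i \<and> a i \<bullet> (v - \<epsilon> *\<^sub>R d) \<le> b i"
    using eventually_happens'[OF trivial_limit_at_right_real] by blast
  moreover have "v \<in> open_segment (v + \<epsilon> *\<^sub>R d) (v - \<epsilon> *\<^sub>R d)"
  proof -
    have "v = midpoint (v + \<epsilon> *\<^sub>R d) (v - \<epsilon> *\<^sub>R d)"
      by (simp add: midpoint_def scaleR_2[symmetric])
    moreover have "v + \<epsilon> *\<^sub>R d \<noteq> v - \<epsilon> *\<^sub>R d"
    proof
      assume "v + \<epsilon> *\<^sub>R d = v - \<epsilon> *\<^sub>R d"
      then have "(\<epsilon> + \<epsilon>) *\<^sub>R d = 0"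
        by (simp only: scaleR_left_distrib) (simp add: algebra_simps)
      then show False
        using \<open>d \<noteq> 0\<close> \<open>\<epsilon> > 0\<close> by simp
    qed
    ultimately show ?thesis
      by (metis midpoint_in_open_segment)
  qed
  ultimately show False
    using v by (auto simp: extreme_point_of_def)
qed

section \<open>Arcs as steps of a walk\<close>

lemma cw_dist_bounds:
  assumes "0 \<le> u" "u < 1" "0 \<le> v" "v < 1"
  shows "0 \<le> cw_dist u v" "cw_dist u v \<le> 1"
  using assms by (auto simp: cw_dist_def)

lemma cw_dist_left_inj:
  assumes "0 \<le> v" "v < 1" "0 \<le> w" "w < 1" "cw_dist u v = cw_dist u w"
  shows "v = w"
  using assms by (auto simp: cw_dist_def split: if_splits)

text \<open>This recovers a step from the positions modulo 1 before and after it. A step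
  \<open>t = 1\<close> would be lost, since it returns to its start and has arc 0.\<close>

lemma cw_dist_frac:
  assumes "0 \<le> t" "t < 1"
  shows "cw_dist (frac u) (frac (u + t)) = t"
proof -
  have "frac t = t" using assms by (simp add: frac_eq)
  then show ?thesis
    using assms by (simp add: frac_add cw_dist_def)
qed

section \<open>Coordinates and partial sums\<close>

locale coordinates =
  fixes e :: "nat \<Rightarrow> 'n::finite" and n :: nat
  assumes bij_e: "bij_betw e {1..n} UNIV"
begin

definition vec_of :: "(nat \<Rightarrow> real) \<Rightarrow> real ^ 'n" where
  "vec_of f = (\<chi> a. f (inv_into {1..n} e a))"

lemma vec_of_nth [simp]: "j \<in> {1..n} \<Longrightarrow> vec_of f $ e j = f j"
  using bij_betw_inv_into_left[OF bij_e] by (simp add: vec_of_def)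

lemma all_coord: "(\<forall>a. P a) \<longleftrightarrow> (\<forall>j\<in>{1..n}. P (e j))"
  using bij_e unfolding bij_betw_def by (metis UNIV_I image_iff)

lemma vec_eq_coord: "x = y \<longleftrightarrow> (\<forall>j\<in>{1..n}. x $ e j = y $ e j)" for x y :: "real ^ 'n"
  unfolding vec_eq_iff by (rule all_coord)

text \<open>The functional taking \<open>x\<close> to its \<open>j\<close>-th partial sum is kept as
  a vector, so that the constraints are half-spaces and hyperplanes in inner-product form.\<close>

definition psum_vec :: "nat \<Rightarrow> real ^ 'n" where
  "psum_vec j = (\<Sum>i = 1..j. axis (e i) 1)"

lemma psum_vec_inner: "psum_vec j \<bullet> x = (\<Sum>i = 1..j. x $ e i)"
  by (simp add: psum_vec_def inner_sum_left inner_axis')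

lemma psum_vec_0 [simp]: "psum_vec 0 = 0"
  by (simp add: psum_vec_def)

lemma psum_vec_step: "j \<in> {1..n} \<Longrightarrow> psum_vec j = psum_vec (j - 1) + axis (e j) 1"
  by (cases j) (auto simp: psum_vec_def)

lemma psum_vec_diff_inner:
  assumes "a \<le> b"
  shows "(psum_vec b - psum_vec a) \<bullet> x = (\<Sum>i = a + 1..b. x $ e i)"
proof -
  have "{1..b} = {1..a} \<union> {a + 1..b}" using assms by auto
  then have "(\<Sum>i = 1..b. x $ e i) = (\<Sum>i = 1..a. x $ e i) + (\<Sum>i = a + 1..b. x $ e i)"
    by (simp add: sum.union_disjoint)
  then show ?thesis
    by (simp add: inner_diff_left psum_vec_inner)
qed

section \<open>Integrality of the polytope\<close>

text \<open>In terms of the partial sums \<open>s\<^sub>j = x\<^sub>1 + \<dots> + x\<^sub>j\<close>, a triple \<open>(a, b, m)\<close> stands for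
  \<open>s\<^sub>b - s\<^sub>a \<le> m\<close>.\<close>

definition difference_constraints :: "nat \<Rightarrow> (nat \<times> nat \<times> int) set" where
  "difference_constraints k = (\<lambda>j. (j - 1, j, 1)) ` {1..n} \<union> (\<lambda>j. (j, j - 1, 0)) ` {1..n} \<union>
    (\<lambda>i. (i, i + k, 1)) ` {i. i + k \<le> n}"

lemma B_hat_difference_constraints:
  "B_hat e k n = {x. \<forall>c\<in>difference_constraints k.
     (psum_vec (fst (snd c)) - psum_vec (fst c)) \<bullet> x \<le> of_int (snd (snd c))}"
proof -
  have "(psum_vec j - psum_vec (j - 1)) \<bullet> x = x $ e j" "(psum_vec (j - 1) - psum_vec j) \<bullet> x = - x $ e j"
    if "j \<in> {1..n}" for j and x :: "real ^ 'n"
    using psum_vec_step[OF that] by (simp_all add: inner_axis')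
  then show ?thesis
    by (auto simp: B_hat_def difference_constraints_def ball_Un psum_vec_diff_inner)
qed

lemma finite_difference_constraints: "finite (difference_constraints k)"
proof -
  have "finite {i. i + k \<le> n}"
    by (rule finite_subset[of _ "{..n}"]) auto
  then show ?thesis by (simp add: difference_constraints_def)
qed

lemma B_hat_subset_cube: "B_hat e k n \<subseteq> cbox 0 1"
  unfolding B_hat_def mem_box_cart subset_iff all_coord by auto

lemma polytope_B_hat: "polytope (B_hat e k n)"
proof -
  have eq: "B_hat e k n = (\<Inter>c\<in>difference_constraints k.
     {x. (psum_vec (fst (snd c)) - psum_vec (fst c)) \<bullet> x \<le> of_int (snd (snd c))})"
    unfolding B_hat_difference_constraints by auto
  have "polyhedron (B_hat e k n)"
    unfolding eq using finite_difference_constraints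
    by (intro polyhedron_Inter) (auto simp only: finite_imageI polyhedron_halfspace_le)
  moreover have "bounded (B_hat e k n)"
    using B_hat_subset_cube bounded_cbox bounded_subset by blast
  ultimately show ?thesis
    by (simp add: polytope_eq_bounded_polyhedron)
qed

text \<open>If some partial sum of a vertex is not an integer, then all partial sums with the same
  fractional part can be shifted simultaneously without changing any tight constraint.\<close>

lemma extreme_point_B_hat_integral:
  assumes v: "v extreme_point_of B_hat e k n"
  shows "v $ a \<in> \<int>"
proof -
  define s where "s j = psum_vec j \<bullet> v" for j
  have s_Ints: "s j \<in> \<int>" if "j \<le> n" for j
  proof (rule ccontr)
    assume j: "s j \<notin> \<int>"
    define J where "J = {i. frac (s i) = frac (s j)}"
    \<comment> \<open>The entries of \<open>d\<close> are the increments of the indicator function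
      of \<open>J\<close>, so its partial sums are that indicator. The telescoping starts correctly
      because \<open>s 0 = 0\<close> is an integer, hence 0 is not in \<open>J\<close>.\<close>
    define d where "d = vec_of (\<lambda>i. of_bool (i \<in> J) - of_bool (i - 1 \<in> J))"
    have "0 \<notin> J" using j by (simp add: J_def s_def eq_commute[of 0])
    have d_inner: "psum_vec i \<bullet> d = of_bool (i \<in> J)" if "i \<le> n" for i
      using that
    proof (induction i)
      case 0
      then show ?case using \<open>0 \<notin> J\<close> by simp
    next
      case (Suc i)
      then show ?case
        using psum_vec_step[of "Suc i"] by (simp add: inner_add_left inner_axis' d_def)
    qed
    have "d = 0"
    proof (rule tight_direction_at_extreme_point[OF finite_difference_constraints
          v[unfolded B_hat_difference_constraints]])
      fix c assume c: "c \<in> difference_constraints k"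
        and eq: "(psum_vec (fst (snd c)) - psum_vec (fst c)) \<bullet> v = of_int (snd (snd c))"
      obtain a b m where [simp]: "c = (a, b, m)" by (cases c)
      \<comment> \<open>As the bound is an integer, a tight constraint links partial sums of equal
        fractional part: \<open>J\<close> contains both indices or neither, and the constraint is
        constant along \<open>d\<close>.\<close>
      have "s b = s a + of_int m"
        using eq by (simp add: s_def inner_diff_left)
      then have "frac (s b) = frac (s a)"
        by (simp add: frac_def)
      moreover have "a \<le> n" "b \<le> n"
        using c by (auto simp: difference_constraints_def)
      ultimately show "(psum_vec (fst (snd c)) - psum_vec (fst c)) \<bullet> d = 0"
        by (simp add: inner_diff_left d_inner J_def)
    qed
    then show False
      using d_inner[OF that] by (simp add: J_def)
  qed
  have "\<forall>a. v $ a \<in> \<int>"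
    unfolding all_coord
  proof
    fix j assume j: "j \<in> {1..n}"
    have "v $ e j = s j - s (j - 1)"
      using psum_vec_step[OF j] by (simp add: s_def inner_add_left inner_axis')
    then show "v $ e j \<in> \<int>"
      using j s_Ints[of j] s_Ints[of "j - 1"] by auto
  qed
  then show ?thesis by blast
qed

section \<open>Positions on the circle and the steps between them\<close>

text \<open>The vector stores only the positions of \<open>1, ..., n\<close>; the walk starts at
  position 0.\<close>

definition pos :: "real ^ 'n \<Rightarrow> nat \<Rightarrow> real" where
  "pos y j = (if j = 0 then 0 else y $ e j)"

definition steps :: "real ^ 'n \<Rightarrow> real ^ 'n" where
  "steps y = vec_of (\<lambda>j. cw_dist (pos y (j - 1)) (pos y j))"

text \<open>For a permutation \<open>p\<close> of \<open>{1..n}\<close> this is the open simplex of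
  positions that realise \<open>cyclic_of n p\<close>.\<close>

definition alcove :: "(nat \<Rightarrow> nat) \<Rightarrow> (real ^ 'n) set" where
  "alcove p = {y. (\<forall>j\<in>{1..n}. 0 < y $ e j \<and> y $ e j < 1) \<and>
     (\<forall>i\<in>{1..n}. \<forall>j\<in>{1..n}. p i < p j \<longrightarrow> y $ e i < y $ e j)}"

lemma pos_bounds:
  assumes "y \<in> alcove p" "j \<le> n"
  shows "0 \<le> pos y j" "pos y j < 1"
proof -
  have "\<forall>i\<in>{1..n}. 0 < y $ e i \<and> y $ e i < 1"
    using assms(1) by (simp add: alcove_def)
  then show "0 \<le> pos y j" "pos y j < 1"
    using assms(2) by (auto simp: pos_def less_imp_le)
qed

lemma pos_less_iff:
  assumes p: "p permutes {1..n}" and y: "y \<in> alcove p" and "i \<le> n" "j \<le> n"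
  shows "pos y i < pos y j \<longleftrightarrow> p i < p j"
proof -
  have mono: "pos y i < pos y j" if "p i < p j" "i \<le> n" "j \<le> n" for i j
  proof -
    have "j \<noteq> 0"
      using that permutes_fixes_0[OF p] by (metis not_less_zero)
    then show ?thesis
      using y that unfolding alcove_def pos_def by auto
  qed
  show ?thesis
  proof (cases "p i = p j")
    case True
    then have "i = j"
      using permutes_inj[OF p] by (simp add: inj_eq)
    then show ?thesis by simp
  next
    case False
    then show ?thesis
      using mono[of i j] mono[of j i] assms(3,4) by linarith
  qed
qed

text \<open>Arcs always satisfy the unit bounds. Positions in the alcove are ordered like
  \<open>p\<close>, so \<open>sum_cw_dist_le_1_iff_cw\<close> turns each \<open>k\<close>-fold
  inequality into a chain condition. Hence each alcove is sent wholly inside or wholly outside the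
  polytope.\<close>

lemma steps_in_B_hat_iff:
  assumes k: "1 \<le> k" and p: "p permutes {1..n}" and y: "y \<in> alcove p"
  shows "steps y \<in> B_hat e k n \<longleftrightarrow> cyclic_of n p \<in> A_hat k n"
proof -
  have "steps y $ e j \<in> {0..1}" if "j \<in> {1..n}" for j
    using that pos_bounds[OF y, of j] pos_bounds[OF y, of "j - 1"] by (auto simp: steps_def cw_dist_bounds)
  moreover have "(\<Sum>j = i + 1..i + k. steps y $ e j) \<le> 1 \<longleftrightarrow>
      cyclic_chain {0..n} (cyclic_of n p) [i..<i + k + 1]" if i: "i + k \<le> n" for i
  proof -
    have inj: "inj_on (pos y) {i..i + k}"
    proof (rule inj_onI)
      fix a b assume "a \<in> {i..i + k}" "b \<in> {i..i + k}" "pos y a = pos y b"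
      then have "p a = p b"
        using pos_less_iff[OF p y, of a b] pos_less_iff[OF p y, of b a] i by auto
      then show "a = b"
        using permutes_inj[OF p] by (simp add: inj_eq)
    qed
    have "(\<Sum>j = i + 1..i + k. steps y $ e j) = (\<Sum>j = i + 1..i + k. cw_dist (pos y (j - 1)) (pos y j))"
      using i by (intro sum.cong) (auto simp: steps_def)
    also have "\<dots> \<le> 1 \<longleftrightarrow> (\<forall>a. 1 \<le> a \<and> a < k \<longrightarrow> cw (pos y i) (pos y (i + a)) (pos y (i + a + 1)))"
      using i pos_bounds[OF y] inj by (intro sum_cw_dist_le_1_iff_cw) auto
    also have "\<dots> \<longleftrightarrow> (\<forall>a. 1 \<le> a \<and> a < k \<longrightarrow> cw (p i) (p (i + a)) (p (i + a + 1)))"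
    proof (intro all_cong1 imp_cong refl)
      fix a assume "1 \<le> a \<and> a < k"
      then have "i \<le> n" "i + a \<le> n" "i + a + 1 \<le> n" using i by auto
      then show "cw (pos y i) (pos y (i + a)) (pos y (i + a + 1)) \<longleftrightarrow> cw (p i) (p (i + a)) (p (i + a + 1))"
        by (simp only: cw_def pos_less_iff[OF p y])
    qed
    also have "\<dots> \<longleftrightarrow> cyclic_chain {0..n} (cyclic_of n p) [i..<i + k + 1]"
      using cyclic_chain_cyclic_of[OF k i] by simp
    finally show ?thesis .
  qed
  ultimately show ?thesis
    using total_cyclic_order_cyclic_of[OF p] by (simp add: B_hat_def A_hat_def del: upt_Suc)
qed

text \<open>The walk can be retraced from its fixed start, one arc at a time. Allowing two different
  alcoves makes the images of disjoint alcoves disjoint.\<close>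

lemma steps_inj:
  assumes y: "y \<in> alcove p" and z: "z \<in> alcove q" and eq: "steps y = steps z"
  shows "y = z"
proof -
  have "pos y j = pos z j" if "j \<le> n" for j
    using that
  proof (induction j)
    case 0
    then show ?case by (simp add: pos_def)
  next
    case (Suc j)
    have "steps y $ e (Suc j) = steps z $ e (Suc j)" by (simp add: eq)
    then have "cw_dist (pos y j) (pos y (Suc j)) = cw_dist (pos y j) (pos z (Suc j))"
      using Suc by (simp add: steps_def)
    then show ?case
      using Suc.prems pos_bounds[OF y] pos_bounds[OF z] cw_dist_left_inj by blast
  qed
  then show ?thesis
    unfolding vec_eq_coord by (force simp: pos_def)
qed

lemma alcove_inj:
  assumes "p permutes {1..n}" "q permutes {1..n}" "y \<in> alcove p" "y \<in> alcove q"
  shows "p = q"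
proof (rule permutes_eqI[OF assms(1,2)])
  fix i j assume "i \<in> {1..n}" "j \<in> {1..n}"
  then show "p i < p j \<longleftrightarrow> q i < q j"
    using pos_less_iff[OF assms(1,3), of i j] pos_less_iff[OF assms(2,4), of i j] by simp
qed

text \<open>The preimage under \<open>steps\<close> consists of the fractional parts of the partial
  sums. Genericity makes these distinct and nonzero.\<close>

lemma generic_point_in_steps_image:
  assumes x: "x \<in> cbox 0 1"
    and generic: "\<And>a b. a < b \<Longrightarrow> b \<le> n \<Longrightarrow> (psum_vec b - psum_vec a) \<bullet> x \<notin> \<int>"
  obtains p where "p permutes {1..n}" "x \<in> steps ` alcove p"
proof -
  define s where "s j = psum_vec j \<bullet> x" for j
  define y where "y = vec_of (\<lambda>j. frac (s j))"
  have frac_neq: "frac (s a) \<noteq> frac (s b)" if "a < b" "b \<le> n" for a b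
  proof
    assume "frac (s a) = frac (s b)"
    then have "s b - s a = of_int (\<lfloor>s b\<rfloor> - \<lfloor>s a\<rfloor>)"
      by (simp add: frac_def)
    then have "s b - s a \<in> \<int>"
      by (metis Ints_of_int)
    then show False
      using generic[OF that] by (simp add: s_def inner_diff_left)
  qed
  have pos_y: "pos y j = frac (s j)" if "j \<le> n" for j
    using that by (auto simp: pos_def y_def s_def)
  have "steps y = x"
    unfolding vec_eq_coord
  proof
    fix j assume j: "j \<in> {1..n}"
    have step: "s j = s (j - 1) + x $ e j"
      using psum_vec_step[OF j] by (simp add: s_def inner_add_left inner_axis')
    \<comment> \<open>Genericity for consecutive indices excludes a full turn, which
      \<open>cw_dist\<close> would read as 0.\<close>
    have "x $ e j \<noteq> 1"
      using generic[of "j - 1" j] j step by (auto simp: s_def inner_diff_left)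
    then have "0 \<le> x $ e j" "x $ e j < 1"
      using x by (auto simp: mem_box_cart less_le)
    then have "cw_dist (frac (s (j - 1))) (frac (s j)) = x $ e j"
      unfolding step by (rule cw_dist_frac)
    then show "steps y $ e j = x $ e j"
      using j pos_y[of j] pos_y[of "j - 1"] by (auto simp: steps_def)
  qed
  obtain p where p: "p permutes {1..n}"
    and less: "\<And>i j. i \<in> {1..n} \<Longrightarrow> j \<in> {1..n} \<Longrightarrow> p i < p j \<longleftrightarrow> frac (s i) < frac (s j)"
  proof (rule strict_total_order_rank[of "\<lambda>i j. frac (s i) < frac (s j)" n])
    fix i j assume "i \<in> {1..n}" "j \<in> {1..n}" "i \<noteq> j"
    then show "frac (s i) < frac (s j) \<or> frac (s j) < frac (s i)"
      using frac_neq[of i j] frac_neq[of j i] by (cases i j rule: linorder_cases) auto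
  qed auto
  have "0 < frac (s j)" if "j \<in> {1..n}" for j
  proof -
    have "frac (s j) \<noteq> 0" using frac_neq[of 0 j] that by (simp add: s_def)
    then show ?thesis using frac_ge_0[of "s j"] by linarith
  qed
  then have "y \<in> alcove p"
    using less by (simp add: alcove_def y_def frac_lt_1)
  then show ?thesis
    using that p \<open>steps y = x\<close> by blast
qed

section \<open>Volumes\<close>

lemma negligible_nongeneric:
  "negligible {x. \<exists>a b. a < b \<and> b \<le> n \<and> (psum_vec b - psum_vec a) \<bullet> x \<in> \<int>}" (is "negligible ?N")
proof -
  let ?H = "\<lambda>(a, b, m::int). {x. (psum_vec b - psum_vec a) \<bullet> x = of_int m}"
  have "?N \<subseteq> \<Union>(?H ` {(a, b, m). a < b \<and> b \<le> n})"
    by (auto simp: Ints_def)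
  moreover have "negligible (\<Union>(?H ` {(a, b, m). a < b \<and> b \<le> n}))"
  proof (rule negligible_countable_Union)
    fix S assume "S \<in> ?H ` {(a, b, m). a < b \<and> b \<le> n}"
    then obtain a b m where "a < b" and S: "S = {x. (psum_vec b - psum_vec a) \<bullet> x = of_int m}"
      by auto
    \<comment> \<open>Pairing with the all-ones vector gives \<open>b - a\<close>, so the normal of
      the hyperplane is nonzero.\<close>
    have "(psum_vec b - psum_vec a) \<bullet> 1 \<noteq> 0"
      using \<open>a < b\<close> by (simp add: psum_vec_diff_inner)
    then have "psum_vec b - psum_vec a \<noteq> 0" by auto
    then show "negligible S"
      unfolding S by (intro negligible_hyperplane) simp
  qed simp
  ultimately show ?thesis
    using negligible_subset by blast
qed

lemma lmeasurable_alcove: "alcove p \<in> lmeasurable"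
proof (rule measurable_convex)
  have eq: "alcove p = (\<Inter>j\<in>{1..n}. {y. axis (e j) 1 \<bullet> y > 0} \<inter> {y. axis (e j) 1 \<bullet> y < 1}) \<inter>
    (\<Inter>i\<in>{1..n}. \<Inter>j\<in>{j \<in> {1..n}. p i < p j}. {y. (axis (e i) 1 - axis (e j) 1) \<bullet> y < 0})"
    by (auto simp: alcove_def inner_axis' inner_diff_left)
  show "convex (alcove p)"
    unfolding eq by (intro convex_INT convex_Int convex_halfspace_lt convex_halfspace_gt)
  have "alcove p \<subseteq> cbox 0 1"
    unfolding alcove_def mem_box_cart subset_iff all_coord by (auto simp: less_imp_le)
  then show "bounded (alcove p)"
    using bounded_cbox bounded_subset by blast
qed

text \<open>The coordinate permutation \<open>\<sigma>\<close>, which is \<open>p\<close>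
  transported along \<open>e\<close>, carries \<open>alcove id\<close> onto
  \<open>alcove p\<close>.\<close>

lemma measure_alcove:
  assumes p: "p permutes {1..n}"
  shows "measure lebesgue (alcove p) = measure lebesgue (alcove id)"
proof -
  define \<sigma> where "\<sigma> = e \<circ> p \<circ> inv_into {1..n} e"
  have "bij \<sigma>"
    unfolding \<sigma>_def
    using bij_betw_inv_into[OF bij_e] permutes_imp_bij[OF p] bij_e by (intro bij_betw_trans) 
  have \<sigma>: "\<sigma> (e j) = e (p j)" if "j \<in> {1..n}" for j
    using that bij_betw_inv_into_left[OF bij_e] by (simp add: \<sigma>_def)
  have p_in: "p j \<in> {1..n} \<longleftrightarrow> j \<in> {1..n}" for j
    using permutes_in_image[OF p] .
  have inv_in: "inv p j \<in> {1..n} \<longleftrightarrow> j \<in> {1..n}" for j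
    using permutes_in_image[OF permutes_inv[OF p]] .
  have "(\<lambda>x. \<chi> i. x $ \<sigma> i) ` alcove id = alcove p"
  proof (intro equalityI subsetI)
    fix y assume "y \<in> (\<lambda>x. \<chi> i. x $ \<sigma> i) ` alcove id"
    then obtain x where x: "x \<in> alcove id" and y: "y = (\<chi> i. x $ \<sigma> i)" by blast
    then have "y $ e j = x $ e (p j)" if "j \<in> {1..n}" for j
      using that by (simp add: \<sigma>)
    then show "y \<in> alcove p"
      using x p_in unfolding alcove_def by (simp del: atLeastAtMost_iff)
  next
    fix y assume y: "y \<in> alcove p"
    define z where "z = vec_of (\<lambda>j. y $ e (inv p j))"
    have "z \<in> alcove id"
      using y inv_in permutes_inverses(1)[OF p] unfolding alcove_def z_def
      by (simp del: atLeastAtMost_iff)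
    moreover have "y = (\<chi> i. z $ \<sigma> i)"
      unfolding vec_eq_coord using p_in permutes_inverses(2)[OF p] by (simp add: \<sigma> z_def)
    ultimately show "y \<in> (\<lambda>x. \<chi> i. x $ \<sigma> i) ` alcove id" by blast
  qed
  then show ?thesis
    using permute_coordinates_preserves_lebesgue[OF \<open>bij \<sigma>\<close> lmeasurable_alcove] by metis
qed

text \<open>On every alcove \<open>steps\<close> is affine with the same linear part
  \<open>L\<close>, the differences of consecutive positions; only the translation depends on
  \<open>p\<close>.\<close>

lemma measure_steps_alcove:
  obtains c where "\<And>p. p permutes {1..n} \<Longrightarrow>
    steps ` alcove p \<in> lmeasurable \<and> measure lebesgue (steps ` alcove p) = c"
proof -
  define L where "L y = vec_of (\<lambda>j. pos y j - pos y (j - 1))" for y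
  have "linear L"
    by (rule linearI) (auto simp: L_def vec_eq_coord pos_def algebra_simps)
  then obtain d where d: "\<And>S. S \<in> lmeasurable \<Longrightarrow>
      L ` S \<in> lmeasurable \<and> measure lebesgue (L ` S) = d * measure lebesgue S"
    using linear_image_scales_lebesgue by blast
  have "steps ` alcove p \<in> lmeasurable \<and>
      measure lebesgue (steps ` alcove p) = d * measure lebesgue (alcove id)"
    if p: "p permutes {1..n}" for p
  proof -
    \<comment> \<open>Entry \<open>j\<close> is 1 exactly when step \<open>j\<close> passes the
      point 0, which accounts for the \<open>+ 1\<close> in \<open>cw_dist\<close>.\<close>
    define b where "b = vec_of (\<lambda>j. of_bool (p j < p (j - 1)))"
    have "steps y = b + L y" if y: "y \<in> alcove p" for y
      unfolding vec_eq_coord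
    proof
      fix j assume j: "j \<in> {1..n}"
      have "pos y j < pos y (j - 1) \<longleftrightarrow> p j < p (j - 1)"
        using pos_less_iff[OF p y, of j "j - 1"] j by auto
      then show "steps y $ e j = (b + L y) $ e j"
        using j by (simp add: steps_def b_def L_def cw_dist_def flip: not_less)
    qed
    then have "steps ` alcove p = (+) b ` L ` alcove p"
      by (simp add: image_image)
    then show ?thesis
      using d[OF lmeasurable_alcove[of p]] measure_alcove[OF p]
      by (simp add: measure_translation measurable_translation)
  qed
  then show ?thesis using that by blast
qed

text \<open>Up to a null set of nongeneric points, the polytope is the disjoint union of the images
  of the alcoves indexed by \<open>G\<close>, all of volume \<open>c\<close>. The constant is fixed
  before \<open>k\<close>, so a single value of \<open>k\<close> determines it.\<close>

lemma measure_B_hat_proportional: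
  obtains c :: real where "\<And>k. 1 \<le> k \<Longrightarrow> measure lebesgue (B_hat e k n) = c * card (A_hat k n)"
proof -
  obtain c where c: "\<And>p. p permutes {1..n} \<Longrightarrow>
      steps ` alcove p \<in> lmeasurable \<and> measure lebesgue (steps ` alcove p) = c"
    using measure_steps_alcove by blast
  have "measure lebesgue (B_hat e k n) = c * card (A_hat k n)" if k: "1 \<le> k" for k
  proof -
    define G where "G = {p. p permutes {1..n} \<and> cyclic_of n p \<in> A_hat k n}"
    have G: "p permutes {1..n}" if "p \<in> G" for p using that by (simp add: G_def)
    have fin: "finite G"
      using finite_permutations[of "{1..n}"] by (rule finite_subset[rotated]) (auto simp: G_def)
    have "cyclic_of n ` G = A_hat k n"
    proof (intro equalityI subsetI)
      fix \<pi> assume \<pi>: "\<pi> \<in> A_hat k n"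
      then have "total_cyclic_order_on {0..n} \<pi>" by (simp add: A_hat_def)
      then obtain r where "r permutes {1..n}" "cyclic_of n r = \<pi>"
        by (rule total_cyclic_order_rank)
      then show "\<pi> \<in> cyclic_of n ` G" using \<pi> by (auto simp: G_def)
    qed (auto simp: G_def)
    moreover have "inj_on (cyclic_of n) G"
      using inj_on_cyclic_of by (rule inj_on_subset) (auto simp: G_def)
    ultimately have card_G: "card G = card (A_hat k n)"
      using card_image by metis
    let ?U = "\<Union>p\<in>G. steps ` alcove p"
    have "pairwise (\<lambda>p q. disjnt (steps ` alcove p) (steps ` alcove q)) G"
      unfolding pairwise_def disjnt_iff using steps_inj alcove_inj G by blast
    then have "measure lebesgue ?U = (\<Sum>p\<in>G. measure lebesgue (steps ` alcove p))"
      using fin c G by (intro measure_UNION') auto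
    also have "\<dots> = c * card (A_hat k n)"
      using c G card_G by simp
    finally have measure_U: "measure lebesgue ?U = c * card (A_hat k n)" .
    have U: "?U \<in> lmeasurable"
      using fin c G by (intro fmeasurable.finite_UN) auto
    have U_B: "?U \<subseteq> B_hat e k n"
      using steps_in_B_hat_iff[OF k] by (auto simp: G_def)
    have "B_hat e k n - ?U \<subseteq> {x. \<exists>a b. a < b \<and> b \<le> n \<and> (psum_vec b - psum_vec a) \<bullet> x \<in> \<int>}"
    proof (rule subsetI, rule ccontr)
      fix x assume x: "x \<in> B_hat e k n - ?U"
        and "x \<notin> {x. \<exists>a b. a < b \<and> b \<le> n \<and> (psum_vec b - psum_vec a) \<bullet> x \<in> \<int>}"
      then have "x \<in> cbox 0 1" "\<And>a b. a < b \<Longrightarrow> b \<le> n \<Longrightarrow> (psum_vec b - psum_vec a) \<bullet> x \<notin> \<int>"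
        using B_hat_subset_cube by (blast, blast)
      then obtain p where "p permutes {1..n}" "x \<in> steps ` alcove p"
        by (rule generic_point_in_steps_image)
      moreover from this have "p \<in> G"
        using x steps_in_B_hat_iff[OF k] by (auto simp: G_def)
      ultimately show False using x by blast
    qed
    then have "negligible (B_hat e k n - ?U)"
      by (rule negligible_subset[OF negligible_nongeneric])
    \<comment> \<open>Because \<open>?U\<close> lies inside the polytope, this union is just the
      one-sided difference.\<close>
    then have "negligible (?U - B_hat e k n \<union> (B_hat e k n - ?U))"
      using U_B by (simp only: Diff_eq_empty_iff[THEN iffD2] Un_empty_left)
    then show ?thesis
      using measure_negligible_symdiff[OF U] measure_U by simp
  qed
  then show ?thesis using that by blast
qed

text \<open>For \<open>k = 1\<close> the tuples are pairs of distinct points, which are chains by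
  convention.\<close>

lemma A_hat_1: "A_hat 1 n = {\<pi>. total_cyclic_order_on {0..n} \<pi>}"
  by (auto simp: A_hat_def cyclic_chain_def)

text \<open>The case \<open>k = 1\<close> calibrates the constant: the unit cube has volume 1 and
  there are \<open>fact n\<close> cyclic orders, so \<open>c * fact n = 1\<close>.\<close>

lemma measure_B_hat:
  assumes "1 \<le> k"
  shows "fact n * measure lebesgue (B_hat e k n) = card (A_hat k n)"
proof -
  obtain c :: real where c: "\<And>k. 1 \<le> k \<Longrightarrow> measure lebesgue (B_hat e k n) = c * card (A_hat k n)"
    using measure_B_hat_proportional by blast
  have "B_hat e 1 n = cbox 0 1"
    unfolding B_hat_def mem_box_cart all_coord set_eq_iff by auto
  then have "measure lebesgue (B_hat e 1 n) = 1"
    by (simp add: content_cbox_if_cart interval_eq_empty_cart)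
  moreover have "card (A_hat 1 n) = fact n"
    using bij_betw_same_card[OF bij_betw_cyclic_of[of n]] card_permutations[of "{1..n}" n]
    by (simp add: A_hat_1[unfolded One_nat_def])
  ultimately have "c * fact n = 1"
    using c[of 1] by simp
  then show ?thesis
    using c[OF assms] by (simp add: mult.assoc[symmetric] mult.commute)
qed

end

theorem theorem2p1:
  fixes k n :: nat and e :: "nat \<Rightarrow> 'n::finite"
  assumes "1 \<le> k" and "k \<le> n"
    and "bij_betw e {1..n} (UNIV :: 'n set)"
  shows "lattice_polytope (B_hat e k n) \<and>
    fact n * measure lebesgue (B_hat e k n) = real (card (A_hat k n))"
proof -
  interpret coordinates e n
    using assms(3) by unfold_locales
  show ?thesis
    using polytope_B_hat extreme_point_B_hat_integral measure_B_hat[OF assms(1)]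
    by (simp add: lattice_polytope_def)
qed

end
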